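(* Let $\lambda, x\in\mathbb{C}$ and $k\in\mathbb{Z}$. For every integer $n\ge 0$, \[ \beta_n^{(k)}(x\mid\lambda)=\sum_{l=0}^{n}\binom{n}{l}\left(\sum_{p=1}^{l+1}\frac{(-1)^{p+l+1}\,p!}{p^k}\,\frac{S_2(l+1,p)}{l+1}\right)\beta_{n-l}(x\mid\lambda). \]
   Context: All generating functions are formal power series in $t$. For $\lambda,x\in\mathbb{C}$ put $(x\mid\lambda)_0=1$ and $(x\mid\lambda)_n=x(x-\lambda)(x-2\lambda)\cdots(x-(n-1)\lambda)$ for $n\ge1$. The series $(1+\lambda t)^{x/\lambda}$ means $\sum_{m\ge0}(x\mid\lambda)_m\frac{t^m}{m!}$ (for $\lambda=0$, the limiting case, this is $e^{xt}$). For $k\in\mathbb{Z}$, $\mathrm{Li}_k(z)=\sum_{n=1}^\infty \frac{z^n}{n^k}$. The degenerate Bernoulli polynomials $\beta_n(x\mid\lambda)$ are defined by \[ \frac{t}{(1+\lambda t)^{1/\lambda}-1}(1+\lambda t)^{x/\lambda}=\sum_{n=0}^\infty \beta_n(x\mid\lambda)\frac{t^n}{n!}. \] The degenerate poly-Bernoulli polynomials $\beta_n^{(k)}(x\mid\lambda)$ are defined by \[ \frac{\mathrm{Li}_k(1-e^{-t})}{(1+\lambda t)^{1/\lambda}-1}(1+\lambda t)^{x/\lambda}=\sum_{n=0}^\infty \beta_n^{(k)}(x\mid\lambda)\frac{t^n}{n!}. \] $S_2(n,l)$ denotes the Stirling numbers of the second kind, given by $x^n=\sum_{l=0}^n S_2(n,l)\,x(x-1)\cdots(x-l+1)$.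 *)

theory Defs
  imports
    Complex_Main
    "HOL-Computational_Algebra.Formal_Power_Series"
    "HOL-Combinatorics.Stirling"
begin

definition degfact :: "complex \<Rightarrow> complex \<Rightarrow> nat \<Rightarrow> complex" where
  "degfact lam x n = (\<Prod>i<n. x - of_nat i * lam)"

text \<open>The formal power series \<open>(1 + \<lambda>t)^(x/\<lambda>)\<close>, with the limiting case \<open>\<lambda> = 0\<close> included.\<close>

definition degexp :: "complex \<Rightarrow> complex \<Rightarrow> complex fps" where
  "degexp lam x = Abs_fps (\<lambda>m. degfact lam x m / fact m)"

lemma degexp_0_left: "degexp 0 x = fps_exp x"
  by (simp add: degexp_def degfact_def fps_eq_iff)

lemma degexp_eq_binomial:
  assumes "lam \<noteq> 0"
  shows "degexp lam x = fps_compose (fps_binomial (x / lam)) (fps_const lam * fps_X)"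
proof (rule fps_ext)
  fix n
  have "degfact lam x n = lam ^ n * (\<Prod>i = 0..<n. x / lam - of_nat i)"
  proof -
    have "degfact lam x n = (\<Prod>i<n. lam * (x / lam - of_nat i))"
      unfolding degfact_def using assms by (intro prod.cong) (auto simp: field_simps)
    also have "\<dots> = lam ^ n * (\<Prod>i = 0..<n. x / lam - of_nat i)"
      by (simp add: prod.distrib lessThan_atLeast0)
    finally show ?thesis .
  qed
  then show "fps_nth (degexp lam x) n =
      fps_nth (fps_compose (fps_binomial (x / lam)) (fps_const lam * fps_X)) n"
    by (simp add: degexp_def fps_compose_linear gbinomial_prod_rev)
qed

definition polylog_fps :: "int \<Rightarrow> complex fps" where
  "polylog_fps k = Abs_fps (\<lambda>n. if n = 0 then 0 else 1 / of_nat n powi k)"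

text \<open>
  The quotients below are divisions by a series of subdegree 1. Division of formal power
  series is exact here because both numerators also have zero constant term; see
  \<open>degenerate_bernoulli_division\<close> and \<open>degenerate_poly_bernoulli_division\<close>.
\<close>

definition degenerate_bernoulli :: "nat \<Rightarrow> complex \<Rightarrow> complex \<Rightarrow> complex" where
  "degenerate_bernoulli n x lam =
     fact n * fps_nth (fps_X / (degexp lam 1 - 1) * degexp lam x) n"

definition degenerate_poly_bernoulli :: "int \<Rightarrow> nat \<Rightarrow> complex \<Rightarrow> complex \<Rightarrow> complex" where
  "degenerate_poly_bernoulli k n x lam =
     fact n * fps_nth
       (fps_compose (polylog_fps k) (1 - fps_exp (-1)) / (degexp lam 1 - 1) * degexp lam x) n"

lemma subdegree_degexp_minus_1: "subdegree (degexp lam 1 - 1) = 1"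
  by (rule subdegreeI) (auto simp: degexp_def degfact_def)

lemma degexp_minus_1_nonzero: "degexp lam 1 - 1 \<noteq> 0"
  using subdegree_degexp_minus_1[of lam] by (metis subdegree_0 zero_neq_one)

lemma degexp_division_exact:
  assumes "fps_nth f 0 = 0"
  shows "f / (degexp lam 1 - 1) * (degexp lam 1 - 1) = f"
proof (cases "f = 0")
  case False
  then have "subdegree f \<ge> 1"
    using assms by (intro subdegree_geI) auto
  then have "subdegree (degexp lam 1 - 1) \<le> subdegree f"
    by (simp only: subdegree_degexp_minus_1)
  then show ?thesis
    by (rule fps_times_divide_eq[OF degexp_minus_1_nonzero])
qed simp

lemma degenerate_bernoulli_division:
  "fps_X / (degexp lam 1 - 1) * (degexp lam 1 - 1) = fps_X"
  by (rule degexp_division_exact) simp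

lemma degenerate_poly_bernoulli_division:
  "fps_compose (polylog_fps k) (1 - fps_exp (-1)) / (degexp lam 1 - 1) * (degexp lam 1 - 1) =
     fps_compose (polylog_fps k) (1 - fps_exp (-1))"
  by (rule degexp_division_exact) (simp add: polylog_fps_def)

text \<open>
  \<open>Stirling\<close> is defined in the library by its recurrence; it satisfies the usual
  defining relation for the Stirling numbers of the second kind.
\<close>

lemma Stirling_falling_factorial:
  fixes x :: complex
  shows "x ^ n = (\<Sum>l\<le>n. of_nat (Stirling n l) * (\<Prod>i<l. x - of_nat i))"
proof (induction n)
  case (Suc n)
  define F where "F l = (\<Prod>i<l. x - of_nat i)" for l
  have F: "x * F l = F (Suc l) + of_nat l * F l" for l
    by (simp add: F_def algebra_simps)
  have "x ^ Suc n = (\<Sum>l\<le>n. of_nat (Stirling n l) * (x * F l))"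
    using Suc by (simp add: F_def sum_distrib_left mult_ac)
  also have "\<dots> = (\<Sum>l\<le>n. of_nat (Stirling n l) * F (Suc l)) +
                  (\<Sum>l\<le>n. of_nat (l * Stirling n l) * F l)"
    by (simp add: F algebra_simps sum.distrib)
  also have "(\<Sum>l\<le>n. of_nat (l * Stirling n l) * F l) =
             (\<Sum>l\<le>Suc n. of_nat (l * Stirling n l) * F l)"
    by simp
  also have "\<dots> = (\<Sum>l\<le>n. of_nat (Suc l * Stirling n (Suc l)) * F (Suc l))"
    by (subst sum.atMost_Suc_shift) simp
  also have "(\<Sum>l\<le>n. of_nat (Stirling n l) * F (Suc l)) + \<dots> =
             (\<Sum>l\<le>n. of_nat (Stirling (Suc n) (Suc l)) * F (Suc l))"
    by (simp add: sum.distrib[symmetric] algebra_simps)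
  also have "\<dots> = (\<Sum>l\<le>Suc n. of_nat (Stirling (Suc n) l) * F l)"
    by (subst sum.atMost_Suc_shift) simp
  finally show ?case by (simp add: F_def)
qed simp

end

theory Submission
  imports Defs
begin

text \<open>
  The two generating functions share the factor
  \<open>(1 + \<lambda>t)^(x/\<lambda>) / ((1 + \<lambda>t)^(1/\<lambda>) - 1)\<close>, so the quotient of the poly-Bernoulli one
  by the Bernoulli one is \<open>Li_k(1 - exp(-t)) / t\<close>, and the identity is the Cauchy product
  of exponential generating functions. It remains to expand \<open>Li_k(1 - exp(-t))\<close>. The
  classical expansion \<open>(exp t - 1)^p = p! \<Sum>\<^sub>n S\<^sub>2(n,p) t^n/n!\<close> becomes, under
  \<open>t \<mapsto> -t\<close> and up to the sign \<open>(-1)^p\<close>, the expansion of the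
  powers of \<open>1 - exp(-t)\<close> that occur in the polylogarithm
  (\<open>fps_nth_power_one_minus_exp\<close>). Dividing by \<open>t\<close> shifts the index to \<open>l + 1\<close>, and
  the ratio \<open>l!/(l + 1)!\<close> produces the denominator \<open>l + 1\<close>.
\<close>

text \<open>
  The series \<open>E = 1 - exp(-t)\<close> satisfies \<open>E' = 1 - E\<close>, hence
  \<open>(E^(p+1))' = (p+1) (E^p - E^(p+1))\<close>. Read off at \<open>t^n\<close>, this is the recurrence of the
  Stirling numbers up to the factor \<open>p!\<close> and the alternating sign.
\<close>

lemma fps_nth_power_one_minus_exp:
  fixes n p :: nat
  shows "fps_nth ((1 - fps_exp (-1 :: 'a :: field_char_0)) ^ p) n =
    (-1) ^ (n + p) * fact p * of_nat (Stirling n p) / fact n"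
proof (induction n arbitrary: p)
  case 0
  show ?case by (cases p) simp_all
next
  case (Suc n)
  show ?case
  proof (cases p)
    case 0
    then show ?thesis by simp
  next
    case p: (Suc q)
    define E :: "'a fps" where "E = 1 - fps_exp (-1)"
    have E': "fps_deriv E = 1 - E"
      by (simp add: E_def fps_const_neg [symmetric] del: fps_const_neg)
    have "fps_deriv (E ^ Suc q) = of_nat (Suc q) * (E ^ q - E ^ Suc q)"
      by (subst fps_deriv_power') (simp add: E' left_diff_distrib mult.assoc del: of_nat_Suc)
    then have "of_nat (Suc n) * fps_nth (E ^ Suc q) (Suc n) =
        of_nat (Suc q) * (fps_nth (E ^ q) n - fps_nth (E ^ Suc q) n)"
      by (metis Suc_eq_plus1 fps_deriv_nth fps_sub_nth fps_of_nat fps_mult_left_const_nth)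
    also have "\<dots> = of_nat (Suc q) * ((-1) ^ (n + q) * fact q * of_nat (Stirling n q) / fact n
        - (-1) ^ (n + Suc q) * fact (Suc q) * of_nat (Stirling n (Suc q)) / fact n)"
      unfolding E_def Suc.IH ..
    also have "\<dots> = (-1) ^ (Suc n + Suc q) * fact (Suc q) * of_nat (Stirling (Suc n) (Suc q)) / fact n"
      by (simp add: field_simps)
    also have "\<dots> = of_nat (Suc n) * ((-1) ^ (Suc n + Suc q) * fact (Suc q) *
        of_nat (Stirling (Suc n) (Suc q)) / fact (Suc n))"
      by (simp add: divide_simps del: of_nat_Suc power_Suc Stirling.simps)
    finally show ?thesis
      unfolding p E_def by (simp only: mult_cancel_left of_nat_eq_0_iff) simp
  qed
qed

text \<open>
  The finite sum is exact because \<open>(1 - exp(-t))^p\<close> starts in degree \<open>p\<close>; the term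
  \<open>p = 0\<close> vanishes with the constant coefficient of the polylogarithm.
\<close>

lemma fps_nth_polylog_one_minus_exp:
  "fps_nth (fps_compose (polylog_fps k) (1 - fps_exp (-1))) m =
    (\<Sum>p=1..m. (-1) ^ (p + m) * fact p / of_nat p powi k * (of_nat (Stirling m p) / fact m))"
proof -
  have "fps_nth (fps_compose (polylog_fps k) (1 - fps_exp (-1))) m =
      (\<Sum>p=1..m. fps_nth (polylog_fps k) p * fps_nth ((1 - fps_exp (-1)) ^ p) m)"
    unfolding fps_compose_nth by (rule sum.mono_neutral_right) (auto simp: polylog_fps_def Suc_le_eq)
  also have "\<dots> =
      (\<Sum>p=1..m. (-1) ^ (p + m) * fact p / of_nat p powi k * (of_nat (Stirling m p) / fact m))"
    by (intro sum.cong refl) (simp add: fps_nth_power_one_minus_exp polylog_fps_def add.commute)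
  finally show ?thesis .
qed

theorem theorem2p2:
  fixes lam x :: complex and k :: int and n :: nat
  shows "degenerate_poly_bernoulli k n x lam =
    (\<Sum>l=0..n. of_nat (n choose l) *
       (\<Sum>p=1..l+1. (-1) ^ (p + l + 1) * fact p / of_nat p powi k *
          (of_nat (Stirling (l + 1) p) / of_nat (l + 1))) *
       degenerate_bernoulli (n - l) x lam)"
proof -
  define L where "L = fps_compose (polylog_fps k) (1 - fps_exp (-1))"
  define G where "G = fps_shift 1 L"
  define D where "D = degexp lam 1 - 1"
  define B where "B = fps_X / D * degexp lam x"
  define c where "c l = (\<Sum>p=1..l+1. (-1) ^ (p + l + 1) * fact p / of_nat p powi k *
          (of_nat (Stirling (l + 1) p) / (of_nat (l + 1) :: complex)))" for l
  have "fps_nth L 0 = 0"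
    by (simp add: L_def polylog_fps_def)
  then have L: "L = G * fps_X"
    by (intro fps_ext) (simp add: G_def)
  \<comment> \<open>\<open>D\<close> is not a unit, so \<open>(G * X) / D = G * (X / D)\<close> rests on \<open>X / D\<close> being exact:
    both sides have the same product with \<open>D\<close>, which can then be cancelled.\<close>
  have "L / D * D = (G * (fps_X / D)) * D"
    using degenerate_poly_bernoulli_division[of k lam] degenerate_bernoulli_division[of lam]
    by (simp add: L_def [symmetric] D_def [symmetric] L mult.assoc)
  then have "L / D = G * (fps_X / D)"
    using degexp_minus_1_nonzero[of lam] by (simp add: D_def)
  then have series: "L / D * degexp lam x = G * B"
    by (simp add: B_def mult.assoc)
  have c: "fact l * fps_nth G l = c l" for l
    by (simp add: G_def L_def c_def fps_nth_polylog_one_minus_exp sum_distrib_left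
        field_simps del: of_nat_Suc Stirling.simps)
  have "degenerate_poly_bernoulli k n x lam = fact n * fps_nth (G * B) n"
    by (simp add: degenerate_poly_bernoulli_def series [symmetric] L_def D_def)
  also have "\<dots> = (\<Sum>l=0..n. fact n * (fps_nth G l * fps_nth B (n - l)))"
    by (simp add: fps_mult_nth sum_distrib_left)
  also have "\<dots> = (\<Sum>l=0..n. of_nat (n choose l) * c l * degenerate_bernoulli (n - l) x lam)"
    by (intro sum.cong refl)
      (simp add: binomial_fact c [symmetric] degenerate_bernoulli_def B_def D_def)
  finally show ?thesis
    by (simp only: c_def)
qed

end
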